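(* Let $P$ be a finite poset with $d$ elements, let $K$ be a maximal chain in $\mathcal{F}^{(e)}(P)$, and put $C=\operatorname{supp}(K)$, $\varepsilon=\operatorname{sgn}(K)$. Let $(v_1,\dots,v_d)$ be the linear extension and $C_1,\dots,C_d$ the chains of $P$ associated to $C$. For $i=1,\dots,d$ put $$\tilde M^K_i(f)=\sum_{l=1}^r\varepsilon(u_l)\prod_{j=l+1}^r(1-\varepsilon(u_j))\,f(u_l)\quad(f\in\mathbb{R}^P),$$ where $C_i=\{u_1\lessdot u_2\lessdot\dots\lessdot u_r=v_i\}$. Then the face $S^{(e)}_K=\operatorname{conv}K$ of the triangulation $\mathcal{S}^{(e)}_P$ of $\mathcal{O}^{(e)}(P)$ is given by $$S^{(e)}_K=\{f\in\mathbb{R}^P : 0\le\tilde M^K_1(f)\le\tilde M^K_2(f)\le\dots\le\tilde M^K_d(f)\le 1\}.$$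
   Context: For $f\in\mathbb{R}^P$ (real-valued functions on $P$), $\operatorname{supp}(f)=\{v\in P: f(v)\neq 0\}$. An order filter of $P$ is a subset $F\subset P$ such that $v\in F$ and $v<w$ imply $w\in F$; $v\lessdot w$ means $w$ covers $v$. $\mathcal{F}^{(e)}(P)$ is the set of $f:P\to\{1,0,-1\}$ such that $\operatorname{supp}(f)$ is an order filter of $P$, and if $f(v)=-1$ then $v$ is minimal in $\operatorname{supp}(f)$. It is partially ordered: $f>g$ if (i) $\operatorname{supp}(f)\supsetneq\operatorname{supp}(g)$; (ii) $f(v)\ge g(v)$ for any $v\in\operatorname{supp}(g)$; (iii) if $v\in\operatorname{supp}(g)$ and $v$ is minimal in $\operatorname{supp}(f)$, then $f(v)=g(v)$. $\mathcal{O}^{(e)}(P)=\operatorname{conv}\mathcal{F}^{(e)}(P)$, and $\mathcal{S}^{(e)}_P=\{\operatorname{conv}K: K\text{ a chain in }\mathcal{F}^{(e)}(P)\}$, which is a triangulation of $\mathcal{O}^{(e)}(P)$. For a chain $K=\{f_1>\dots>f_k\}$ of $\mathcal{F}^{(e)}(P)$: $\operatorname{supp}(K)$ is the chain of order filters $\{\operatorname{supp}(f_1)\supsetneq\dots\supsetneq\operatorname{supp}(f_k)\}$, and $\operatorname{sgn}(K)$ is the map $\varphi:P\to\{1,0,-1\}$ with $\varphi(v)=0$ if $v$ is not minimal in $\operatorname{supp}(f_i)$ for any $i$, and $\varphi(v)=f_i(v)$ if $v$ is minimal in $\operatorname{supp}(f_i)$ for some $i$ (this is independent of the choice of $i$).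 If $K$ is maximal, then $\operatorname{supp}(K)$ is a maximal chain of order filters and $\operatorname{sgn}(K)$ takes values in $\{1,-1\}$. To a maximal chain $C=\{F_0\supsetneq F_1\supsetneq\dots\supsetneq F_d\}$ of order filters of $P$ one associates a linear extension $(v_1,\dots,v_d)$ of $P$, defined by $F_{i-1}=F_i\cup\{v_i\}$ ($i=1,\dots,d$), and chains $C_1,\dots,C_d$ of $P$, defined inductively: $C_i=\{v_i\}$ if $v_i$ is minimal in $P$; otherwise $C_i=\{v_i\}\cup C_j$, where $j$ is the largest index satisfying $v_j\lessdot v_i$. *)

theory Defs
  imports "HOL-Analysis.Analysis" "HOL-Library.Function_Algebras"
begin

text \<open>
  The pointwise real vector space structure on functions, so that \<open>convex hull\<close>
  is available for sets of functions; addition and zero come from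
  \<open>Function_Algebras\<close>.
\<close>

instantiation "fun" :: (type, real_vector) real_vector
begin

definition scaleR_fun_def: "r *\<^sub>R f = (\<lambda>x. r *\<^sub>R f x)"

instance
  by standard (simp_all add: scaleR_fun_def fun_eq_iff scaleR_add_right scaleR_add_left)

end

lemma scaleR_fun_apply [simp]: "(r *\<^sub>R f) x = r *\<^sub>R f x"
  by (simp add: scaleR_fun_def)

text \<open>
  A finite poset is a finite set \<open>P\<close> in a type of class \<open>order\<close>, with the induced
  order.  The empty poset is allowed.
\<close>

definition minimal_in :: "'a::order set \<Rightarrow> 'a \<Rightarrow> bool" where
  "minimal_in S v \<longleftrightarrow> v \<in> S \<and> \<not> (\<exists>u\<in>S. u < v)"

text \<open>\<open>covered_in P v w\<close>: the element \<open>w\<close> covers \<open>v\<close> in \<open>P\<close>.\<close>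

definition covered_in :: "'a::order set \<Rightarrow> 'a \<Rightarrow> 'a \<Rightarrow> bool" where
  "covered_in P v w \<longleftrightarrow> v \<in> P \<and> w \<in> P \<and> v < w \<and> \<not> (\<exists>u\<in>P. v < u \<and> u < w)"

definition order_filter :: "'a::order set \<Rightarrow> 'a set \<Rightarrow> bool" where
  "order_filter P F \<longleftrightarrow> F \<subseteq> P \<and> (\<forall>v\<in>F. \<forall>w\<in>P. v < w \<longrightarrow> w \<in> F)"

text \<open>
  Functions on \<open>P\<close> are represented by functions on the whole type that vanish
  outside \<open>P\<close>.
\<close>

definition functions_on :: "'a set \<Rightarrow> ('a \<Rightarrow> real) set" where
  "functions_on P = {f. \<forall>v. v \<notin> P \<longrightarrow> f v = 0}"

definition supp :: "'a set \<Rightarrow> ('a \<Rightarrow> real) \<Rightarrow> 'a set" where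
  "supp P f = {v \<in> P. f v \<noteq> 0}"

definition enriched_filters :: "'a::order set \<Rightarrow> ('a \<Rightarrow> real) set" where
  "enriched_filters P =
     {f \<in> functions_on P.
        (\<forall>v\<in>P. f v \<in> {1, 0, -1}) \<and>
        order_filter P (supp P f) \<and>
        (\<forall>v\<in>P. f v = -1 \<longrightarrow> minimal_in (supp P f) v)}"

definition enriched_greater :: "'a::order set \<Rightarrow> ('a \<Rightarrow> real) \<Rightarrow> ('a \<Rightarrow> real) \<Rightarrow> bool" where
  "enriched_greater P f g \<longleftrightarrow>
     supp P g \<subset> supp P f \<and>
     (\<forall>v\<in>supp P g. g v \<le> f v) \<and>
     (\<forall>v\<in>supp P g. minimal_in (supp P f) v \<longrightarrow> f v = g v)"

definition maximal_enriched_chain :: "'a::order set \<Rightarrow> ('a \<Rightarrow> real) set \<Rightarrow> bool" where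
  "maximal_enriched_chain P K \<longleftrightarrow>
     pred_on.maxchain (enriched_filters P) (enriched_greater P) K"

definition sgn_chain :: "'a::order set \<Rightarrow> ('a \<Rightarrow> real) set \<Rightarrow> 'a \<Rightarrow> real" where
  "sgn_chain P K v =
     (if \<exists>f\<in>K. minimal_in (supp P f) v
      then THE c. \<exists>f\<in>K. minimal_in (supp P f) v \<and> c = f v
      else 0)"

text \<open>The description in \<open>sgn_chain\<close> is definite for every chain:\<close>

lemma sgn_chain_eq:
  assumes chain: "pred_on.chain (enriched_filters P) (enriched_greater P) K"
    and f: "f \<in> K" and min: "minimal_in (supp P f) v"
  shows "sgn_chain P K v = f v"
proof -
  have "g v = f v" if g: "g \<in> K" "minimal_in (supp P g) v" for g
  proof -
    have "g = f \<or> enriched_greater P g f \<or> enriched_greater P f g"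
      using pred_on.chain_total[OF chain g(1) f] by auto
    then show ?thesis
      using min g(2) by (auto simp: enriched_greater_def minimal_in_def)
  qed
  then have "(THE c. \<exists>f\<in>K. minimal_in (supp P f) v \<and> c = f v) = f v"
    using f min by (intro the_equality) blast+
  then show ?thesis
    using f min unfolding sgn_chain_def by (subst if_P) blast+
qed

text \<open>
  The sequence \<open>v\<^sub>1, \<dots>, v\<^sub>d\<close> (\<open>d = card P\<close>; values of \<open>v\<close> at other indices are irrelevant)
  attached to a maximal chain \<open>F\<^sub>0 \<supset> F\<^sub>1 \<supset> \<dots> \<supset> F\<^sub>d\<close> of order filters of \<open>P\<close>.
\<close>

definition chain_linear_extension :: "'a set \<Rightarrow> 'a set set \<Rightarrow> (nat \<Rightarrow> 'a) \<Rightarrow> bool" where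
  "chain_linear_extension P C v \<longleftrightarrow>
     (\<exists>F :: nat \<Rightarrow> 'a set.
        C = F ` {0..card P} \<and>
        (\<forall>i\<in>{1..card P}. F i \<subset> F (i - 1) \<and> F (i - 1) = F i \<union> {v i}))"

text \<open>
  The chains \<open>C\<^sub>1, \<dots>, C\<^sub>d\<close> attached to \<open>v\<^sub>1, \<dots>, v\<^sub>d\<close>.  The chain
  \<open>C\<^sub>i = {u\<^sub>1 < \<dots> < u\<^sub>r = v\<^sub>i}\<close>, in which each element covers the preceding one, is
  represented by the list \<open>[u\<^sub>1, \<dots>, u\<^sub>r]\<close>.  Because \<open>v\<^sub>i\<close> covers \<open>v\<^sub>j\<close>, appending
  \<open>v\<^sub>i\<close> to the list of \<open>C\<^sub>j\<close> yields such a list again.  For a linear extension one always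
  has \<open>j < i\<close>, so that the equations determine \<open>C\<^sub>1, \<dots>, C\<^sub>d\<close> recursively.
\<close>

definition associated_chains :: "'a::order set \<Rightarrow> (nat \<Rightarrow> 'a) \<Rightarrow> (nat \<Rightarrow> 'a list) \<Rightarrow> bool" where
  "associated_chains P v C \<longleftrightarrow>
     (\<forall>i\<in>{1..card P}.
        C i = (if minimal_in P (v i) then [v i]
               else C (Max {j \<in> {1..card P}. covered_in P (v j) (v i)}) @ [v i]))"

text \<open>Lists are indexed from 0, so \<open>u\<^sub>l\<close> is \<open>u ! (l - 1)\<close>.\<close>

definition M_tilde :: "('a \<Rightarrow> real) \<Rightarrow> 'a list \<Rightarrow> ('a \<Rightarrow> real) \<Rightarrow> real" where
  "M_tilde \<epsilon> u f =
     (\<Sum>l = 1..length u.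
        \<epsilon> (u ! (l - 1)) * (\<Prod>j = l + 1..length u. 1 - \<epsilon> (u ! (j - 1))) * f (u ! (l - 1)))"

end

theory Submission
  imports Defs
begin

text \<open>
  Let \<open>f\<^sub>k\<close> be the vertex of the simplex with support \<open>{v\<^sub>k\<^sub>+\<^sub>1, \<dots>, v\<^sub>d}\<close>; it takes the value
  \<open>\<epsilon>(w)\<close> at the minimal elements \<open>w\<close> of its support and \<open>1\<close> at the others.  The
  recursion \<open>M\<^sub>i(f) = (1 - \<epsilon>(v\<^sub>i)) M\<^sub>j(f) + \<epsilon>(v\<^sub>i) f(v\<^sub>i)\<close>, with \<open>j\<close> the largest index such that
  \<open>v\<^sub>j\<close> is covered by \<open>v\<^sub>i\<close>, gives \<open>M\<^sub>i(f\<^sub>k) = 1\<close> for \<open>k < i\<close> and \<open>M\<^sub>i(f\<^sub>k) = 0\<close> otherwise, and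
  shows that \<open>M\<close> is triangular with diagonal \<open>\<epsilon>(v\<^sub>i) \<noteq> 0\<close>, hence injective.  So \<open>M\<close> carries the
  simplex onto the order simplex \<open>0 \<le> x\<^sub>1 \<le> \<dots> \<le> x\<^sub>d \<le> 1\<close>, in which the barycentric
  coordinates are the successive differences.
\<close>

section \<open>Recursion and linearity of the functionals \<open>M_tilde\<close>\<close>

lemma M_tilde_Nil [simp]: "M_tilde \<epsilon> [] f = 0"
  by (simp add: M_tilde_def)

text \<open>A new top element \<open>w\<close> contributes the factor
  \<open>1 - \<epsilon> w\<close> to every earlier product, and its own term has the empty
  product.\<close>

lemma M_tilde_snoc [simp]:
  "M_tilde \<epsilon> (u @ [w]) f = (1 - \<epsilon> w) * M_tilde \<epsilon> u f + \<epsilon> w * f w"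
proof -
  let ?n = "length u"
  have "(\<Sum>l = 1..?n. \<epsilon> ((u @ [w]) ! (l - 1)) *
          (\<Prod>j = l + 1..Suc ?n. 1 - \<epsilon> ((u @ [w]) ! (j - 1))) * f ((u @ [w]) ! (l - 1)))
      = (\<Sum>l = 1..?n. (1 - \<epsilon> w) * (\<epsilon> (u ! (l - 1)) *
          (\<Prod>j = l + 1..?n. 1 - \<epsilon> (u ! (j - 1))) * f (u ! (l - 1))))"
  proof (rule sum.cong[OF refl])
    fix l assume l: "l \<in> {1..?n}"
    have "(\<Prod>j = l + 1..?n. 1 - \<epsilon> ((u @ [w]) ! (j - 1)))
        = (\<Prod>j = l + 1..?n. 1 - \<epsilon> (u ! (j - 1)))"
      by (rule prod.cong) (auto simp: nth_append)
    then show "\<epsilon> ((u @ [w]) ! (l - 1)) *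
          (\<Prod>j = l + 1..Suc ?n. 1 - \<epsilon> ((u @ [w]) ! (j - 1))) * f ((u @ [w]) ! (l - 1))
        = (1 - \<epsilon> w) * (\<epsilon> (u ! (l - 1)) *
          (\<Prod>j = l + 1..?n. 1 - \<epsilon> (u ! (j - 1))) * f (u ! (l - 1)))"
      using l by (auto simp: nth_append)
  qed
  then show ?thesis
    by (simp add: M_tilde_def sum_distrib_left)
qed

lemma M_tilde_add: "M_tilde \<epsilon> u (f + g) = M_tilde \<epsilon> u f + M_tilde \<epsilon> u g"
  by (simp add: M_tilde_def algebra_simps sum.distrib)

lemma M_tilde_scaleR: "M_tilde \<epsilon> u (c *\<^sub>R f) = c * M_tilde \<epsilon> u f"
  by (simp add: M_tilde_def sum_distrib_left mult_ac)

lemma M_tilde_sum: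
  assumes "finite A"
  shows "M_tilde \<epsilon> u (\<Sum>k\<in>A. c k *\<^sub>R g k) = (\<Sum>k\<in>A. c k * M_tilde \<epsilon> u (g k))"
  using assms
proof (induction A rule: finite_induct)
  case empty
  then show ?case by (simp add: M_tilde_def)
next
  case (insert x A)
  then show ?case
    by (simp only: sum.insert M_tilde_add M_tilde_scaleR not_False_eq_True)
qed

lemma convex_functions_on: "convex (functions_on P)"
  by (simp add: convex_def functions_on_def)

text \<open>Treating the bounds 0 and 1 as entries number 0 and \<open>d + 1\<close> leaves only
  comparisons of neighbours; for \<open>d = 0\<close> the single one is
  \<open>0 \<le> 1\<close>.\<close>

lemma sorted_0_1_iff:
  fixes a :: "nat \<Rightarrow> real"
  shows "sorted ([0] @ map a [1..<d + 1] @ [1]) \<longleftrightarrow>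
    (\<forall>i\<le>d. (if i = 0 then 0 else a i) \<le> (if i = d then 1 else a (Suc i)))"
proof -
  let ?xs = "[0] @ map a [1..<d + 1] @ [1]"
  have len: "length ?xs = Suc (Suc d)"
    by simp
  have "?xs ! i = (if i = 0 then 0 else a i)" "?xs ! Suc i = (if i = d then 1 else a (Suc i))"
    if "i \<le> d" for i
    using that by (auto simp: nth_append nth_Cons' simp del: upt_Suc)
  then show ?thesis
    unfolding sorted_iff_nth_Suc len by auto
qed

section \<open>Linear extensions with signs and the simplices they define\<close>

locale signed_linear_extension =
  fixes P :: "'a::order set" and v :: "nat \<Rightarrow> 'a" and C :: "nat \<Rightarrow> 'a list"
    and \<epsilon> :: "'a \<Rightarrow> real"
  assumes fin: "finite P"
    and bij: "bij_betw v {1..card P} P"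
    and less_imp_less: "\<lbrakk>i \<in> {1..card P}; j \<in> {1..card P}; v i < v j\<rbrakk> \<Longrightarrow> i < j"
    and chains: "associated_chains P v C"
    and sign: "w \<in> P \<Longrightarrow> \<epsilon> w \<in> {1, -1}"
begin

lemma v_in: "i \<in> {1..card P} \<Longrightarrow> v i \<in> P"
  using bij bij_betwE by blast

lemma index_cases:
  assumes "w \<in> P"
  obtains i where "i \<in> {1..card P}" "w = v i"
proof -
  have "w \<in> v ` {1..card P}"
    using assms bij by (simp add: bij_betw_def)
  then show ?thesis using that by blast
qed

lemma v_in_image_iff:
  assumes "i \<in> {1..card P}"
  shows "v i \<in> v ` {k<..card P} \<longleftrightarrow> k < i"
proof
  assume "v i \<in> v ` {k<..card P}"
  then obtain j where "j \<in> {k<..card P}" "v i = v j" by blast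
  moreover have "inj_on v {1..card P}"
    using bij by (rule bij_betw_imp_inj_on)
  ultimately show "k < i"
    using assms by (force dest: inj_onD)
qed (use assms in auto)

lemma chain_minimal:
  assumes "i \<in> {1..card P}" "minimal_in P (v i)"
  shows "C i = [v i]"
  using chains assms by (simp add: associated_chains_def)

text \<open>The index \<open>j\<close> is a maximum over lower covers only, yet it bounds the index
  of everything below \<open>v i\<close>: each such element lies weakly below a lower cover, whose
  index is at least as large.\<close>

lemma chain_not_minimal:
  assumes i: "i \<in> {1..card P}" and nm: "\<not> minimal_in P (v i)"
  obtains j where "j \<in> {1..card P}" "v j < v i" "C i = C j @ [v i]"
    and "\<And>l. \<lbrakk>l \<in> {1..card P}; v l < v i\<rbrakk> \<Longrightarrow> l \<le> j"
proof -
  define J where "J = {j \<in> {1..card P}. covered_in P (v j) (v i)}"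
  have finJ: "finite J" by (simp add: J_def)
  have above: "\<exists>j\<in>J. l \<le> j" if l: "l \<in> {1..card P}" "v l < v i" for l
  proof -
    \<comment> \<open>A maximal element of this set is covered by \<open>v i\<close>.\<close>
    let ?A = "{u \<in> P. v l \<le> u \<and> u < v i}"
    have "finite ?A" "v l \<in> ?A"
      using fin l v_in by auto
    then obtain m where m: "m \<in> ?A" "\<forall>b\<in>?A. m \<le> b \<longrightarrow> m = b"
      using finite_has_maximal2[of ?A "v l"] by blast
    then obtain j where j: "j \<in> {1..card P}" "m = v j"
      using index_cases[of m] by blast
    have "\<not> (m < u \<and> u < v i)" if "u \<in> P" for u
      using m that by (auto simp: less_le dest: order_trans)
    then have "covered_in P m (v i)"
      unfolding covered_in_def using m(1) v_in[OF i] by blast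
    then have "j \<in> J" using j by (simp add: J_def)
    moreover have "l \<le> j"
    proof (cases "v l = v j")
      case True
      then show ?thesis
        using inj_onD[OF bij_betw_imp_inj_on[OF bij] _ l(1) j(1)] by simp
    next
      case False
      then have "v l < v j" using m(1) j by auto
      then show ?thesis using less_imp_less[OF l(1) j(1)] by simp
    qed
    ultimately show ?thesis by blast
  qed
  obtain u where "u \<in> P" "u < v i"
    using nm v_in[OF i] by (auto simp: minimal_in_def)
  then obtain l where "l \<in> {1..card P}" "v l < v i"
    using index_cases by metis
  with above have "J \<noteq> {}" by blast
  then have Max: "Max J \<in> J" using finJ by simp
  show ?thesis
  proof
    show "Max J \<in> {1..card P}" "v (Max J) < v i"
      using Max by (auto simp: J_def covered_in_def)
    show "C i = C (Max J) @ [v i]"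
      using chains i nm by (simp add: associated_chains_def J_def)
    show "l \<le> Max J" if "l \<in> {1..card P}" "v l < v i" for l
      using above[OF that] finJ by (meson Max_ge order_trans)
  qed
qed

text \<open>With \<open>j\<close> as in the recursion there are three cases. If
  \<open>k < j\<close>, the value at \<open>v i\<close> is 1 and the weights
  \<open>1 - \<epsilon> (v i)\<close> and \<open>\<epsilon> (v i)\<close> add up to 1. If
  \<open>j \<le> k < i\<close>, only the square of \<open>\<epsilon> (v i)\<close> remains. If
  \<open>i \<le> k\<close>, both terms vanish.\<close>

lemma M_tilde_vertex:
  assumes supp: "supp P f = v ` {k<..card P}"
    and val: "\<And>w. w \<in> supp P f \<Longrightarrow> f w = (if minimal_in (supp P f) w then \<epsilon> w else 1)"
    and i: "i \<in> {1..card P}"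
  shows "M_tilde \<epsilon> (C i) f = (if k < i then 1 else 0)"
  using i
proof (induction i rule: less_induct)
  case (less i)
  have in_supp: "v l \<in> supp P f \<longleftrightarrow> k < l" if "l \<in> {1..card P}" for l
    using v_in_image_iff[OF that] supp by simp
  have zero: "f (v i) = 0" if "\<not> k < i"
    using in_supp[OF less.prems] that v_in[OF less.prems] by (auto simp: supp_def)
  have sq: "\<epsilon> (v i) * \<epsilon> (v i) = 1"
    using sign[OF v_in[OF less.prems]] by auto
  show ?case
  proof (cases "minimal_in P (v i)")
    case True
    have "f (v i) = \<epsilon> (v i)" if "k < i"
    proof -
      have "v i \<in> supp P f" using that in_supp less.prems by blast
      moreover from this have "minimal_in (supp P f) (v i)"
        using True by (auto simp: minimal_in_def supp_def)
      ultimately show ?thesis using val by simp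
    qed
    moreover have "C i = [] @ [v i]"
      using chain_minimal[OF less.prems True] by simp
    ultimately show ?thesis
      using zero sq by (simp only: M_tilde_snoc M_tilde_Nil) auto
  next
    case False
    then obtain j where j: "j \<in> {1..card P}" "v j < v i" "C i = C j @ [v i]"
      and largest: "\<And>l. \<lbrakk>l \<in> {1..card P}; v l < v i\<rbrakk> \<Longrightarrow> l \<le> j"
      using chain_not_minimal[OF less.prems False] by metis
    have "j < i" using less_imp_less j less.prems by blast
    then have IH: "M_tilde \<epsilon> (C j) f = (if k < j then 1 else 0)"
      using less.IH j(1) by blast
    have "f (v i) = (if k < j then 1 else \<epsilon> (v i))" if "k < i"
    proof -
      have vi: "v i \<in> supp P f" using that in_supp less.prems by blast
      \<comment> \<open>As \<open>j\<close> is the last index of an element below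
        \<open>v i\<close>, the support contains something below \<open>v i\<close> only if it
        contains \<open>v j\<close>.\<close>
      have "minimal_in (supp P f) (v i) \<longleftrightarrow> \<not> k < j"
      proof
        assume "minimal_in (supp P f) (v i)"
        then have "v j \<notin> supp P f" using j(2) by (auto simp: minimal_in_def)
        then show "\<not> k < j" using in_supp j(1) by blast
      next
        assume "\<not> k < j"
        then have "\<not> u < v i" if u: "u \<in> supp P f" for u
        proof -
          obtain l where "l \<in> {k<..card P}" "u = v l"
            using u unfolding supp by blast
          then show ?thesis
            using largest[of l] \<open>\<not> k < j\<close> by auto
        qed
        then show "minimal_in (supp P f) (v i)"
          using vi by (auto simp: minimal_in_def)
      qed
      then show ?thesis using val[OF vi] by simp
    qed
    then show ?thesis
      using j(3) IH zero sq \<open>j < i\<close> by auto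
  qed
qed

lemma M_tilde_inject:
  assumes f: "f \<in> functions_on P" and g: "g \<in> functions_on P"
    and eq: "\<And>i. i \<in> {1..card P} \<Longrightarrow> M_tilde \<epsilon> (C i) f = M_tilde \<epsilon> (C i) g"
  shows "f = g"
proof
  have at_v: "f (v i) = g (v i)" if i: "i \<in> {1..card P}" for i
  proof -
    \<comment> \<open>Both sides agree on the part \<open>u\<close> of the chain below
      \<open>v i\<close>, which is empty or some \<open>C j\<close>; dividing by
      \<open>\<epsilon> (v i)\<close> then gives the value at \<open>v i\<close>.\<close>
    obtain u where Ci: "C i = u @ [v i]" and "M_tilde \<epsilon> u f = M_tilde \<epsilon> u g"
    proof (cases "minimal_in P (v i)")
      case True
      then show ?thesis using that[of "[]"] chain_minimal[OF i] by simp
    next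
      case False
      then obtain j where "j \<in> {1..card P}" "C i = C j @ [v i]"
        using chain_not_minimal[OF i] by metis
      then show ?thesis using that eq by blast
    qed
    then show ?thesis
      using eq[OF i] sign[OF v_in[OF i]] by auto
  qed
  fix w
  show "f w = g w"
  proof (cases "w \<in> P")
    case True
    then obtain i where "i \<in> {1..card P}" "w = v i"
      by (rule index_cases)
    then show ?thesis using at_v by simp
  next
    case False
    then show ?thesis using f g by (simp add: functions_on_def)
  qed
qed

lemma convex_hull_vertices:
  fixes g :: "nat \<Rightarrow> 'a \<Rightarrow> real"
  defines "d \<equiv> card P"
  assumes g_on: "\<And>k. k \<le> d \<Longrightarrow> g k \<in> functions_on P"
    and supp: "\<And>k. k \<le> d \<Longrightarrow> supp P (g k) = v ` {k<..d}"
    and val: "\<And>k w. \<lbrakk>k \<le> d; w \<in> supp P (g k)\<rbrakk> \<Longrightarrow>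
      g k w = (if minimal_in (supp P (g k)) w then \<epsilon> w else 1)"
  shows "convex hull (g ` {..d}) =
    {f \<in> functions_on P. sorted ([0] @ map (\<lambda>i. M_tilde \<epsilon> (C i) f) [1..<d + 1] @ [1])}"
    (is "_ = ?S")
proof
  \<comment> \<open>The coordinates of \<open>f\<close>, extended by the constants 0 at index 0 and
    1 at index \<open>Suc d\<close>.\<close>
  define m where "m f i = (if i = 0 then 0 else if i = Suc d then 1 else M_tilde \<epsilon> (C i) f)"
    for f i
  have S: "?S = {f \<in> functions_on P. \<forall>i\<le>d. m f i \<le> m f (Suc i)}"
    unfolding sorted_0_1_iff m_def by auto
  have M_g: "M_tilde \<epsilon> (C i) (g k) = (if k < i then 1 else 0)" if "k \<le> d" "i \<in> {1..d}" for i k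
    using M_tilde_vertex[of "g k" k i] supp val that by (simp add: d_def)
  show "convex hull (g ` {..d}) \<subseteq> ?S"
  proof (rule hull_minimal)
    show "g ` {..d} \<subseteq> ?S"
      unfolding S using g_on M_g by (auto simp: m_def)
    show "convex ?S"
      unfolding S
    proof (rule convexI)
      fix x y and a b :: real
      assume x: "x \<in> {f \<in> functions_on P. \<forall>i\<le>d. m f i \<le> m f (Suc i)}"
        and y: "y \<in> {f \<in> functions_on P. \<forall>i\<le>d. m f i \<le> m f (Suc i)}"
        and ab: "0 \<le> a" "0 \<le> b" "a + b = 1"
      \<comment> \<open>The constant 1 at index \<open>Suc d\<close> is preserved because
        \<open>a + b = 1\<close>.\<close>
      have "m (a *\<^sub>R x + b *\<^sub>R y) i = a * m x i + b * m y i" for i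
        using ab by (simp add: m_def M_tilde_add M_tilde_scaleR)
      moreover have "a *\<^sub>R x + b *\<^sub>R y \<in> functions_on P"
        using x y ab by (intro convexD[OF convex_functions_on]) auto
      ultimately show "a *\<^sub>R x + b *\<^sub>R y \<in> {f \<in> functions_on P. \<forall>i\<le>d. m f i \<le> m f (Suc i)}"
        using x y ab by (auto intro!: add_mono mult_left_mono)
    qed
  qed
  show "?S \<subseteq> convex hull (g ` {..d})"
  proof
    fix f assume "f \<in> ?S"
    then have f: "f \<in> functions_on P" and mono: "\<And>i. i \<le> d \<Longrightarrow> m f i \<le> m f (Suc i)"
      unfolding S by auto
    \<comment> \<open>These will be the barycentric coordinates: by telescoping, the sum of those
      with \<open>k < i\<close> is coordinate \<open>i\<close>.\<close>
    define c where "c k = m f (Suc k) - m f k" for k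
    have tel: "(\<Sum>k<i. c k) = m f i" for i
      using sum_lessThan_telescope[of "m f" i] by (simp add: c_def m_def)
    have c_nonneg: "\<And>k. k \<in> {..d} \<Longrightarrow> 0 \<le> c k"
      using mono by (simp add: c_def)
    have c_sum: "sum c {..d} = 1"
      using tel[of "Suc d"] by (simp add: m_def lessThan_Suc_atMost)
    let ?h = "\<Sum>k\<in>{..d}. c k *\<^sub>R g k"
    have "f = ?h"
    proof (rule M_tilde_inject)
      show "f \<in> functions_on P" by (rule f)
      show "?h \<in> functions_on P"
        by (rule convex_sum[OF _ convex_functions_on c_sum c_nonneg]) (use g_on in auto)
      fix i assume "i \<in> {1..card P}"
      then have i: "i \<in> {1..d}" by (simp add: d_def)
      have "M_tilde \<epsilon> (C i) ?h = (\<Sum>k\<in>{..d}. c k * (if k < i then 1 else 0))"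
        using M_g i by (simp add: M_tilde_sum)
      also have "\<dots> = (\<Sum>k<i. c k)"
        by (rule sum.mono_neutral_cong_right) (use i in auto)
      also have "\<dots> = M_tilde \<epsilon> (C i) f"
        using i by (simp add: tel m_def)
      finally show "M_tilde \<epsilon> (C i) f = M_tilde \<epsilon> (C i) ?h" by simp
    qed
    also have "?h \<in> convex hull (g ` {..d})"
      by (rule convex_sum[OF _ convex_convex_hull c_sum c_nonneg]) (auto intro: hull_inc)
    finally show "f \<in> convex hull (g ` {..d})" .
  qed
qed

end

section \<open>Recovering the linear extension and the signs from the chain\<close>

lemma chain_linear_extensionE:
  assumes "chain_linear_extension P \<C> v" and fin: "finite P"
    and sub: "\<And>A. A \<in> \<C> \<Longrightarrow> A \<subseteq> P"
  obtains "bij_betw v {1..card P} P" and "\<C> = (\<lambda>k. v ` {k<..card P}) ` {..card P}"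
proof -
  let ?d = "card P"
  obtain F where F_chain:
    "\<C> = F ` {0..?d} \<and> (\<forall>i\<in>{1..?d}. F i \<subset> F (i - 1) \<and> F (i - 1) = F i \<union> {v i})"
    using assms(1) unfolding chain_linear_extension_def ..
  note \<C> = conjunct1[OF F_chain]
  have F_sub: "F i \<subseteq> P" if "i \<le> ?d" for i
    using sub that \<C> by auto
  \<comment> \<open>Descending from index \<open>card P\<close>, each step adjoins exactly one new
    element.\<close>
  have F_eq: "F i = F ?d \<union> v ` {i<..?d} \<and> card (F i) = card (F ?d) + (?d - i)" if "i \<le> ?d" for i
    using that
  proof (induction i rule: inc_induct)
    case base
    then show ?case by simp
  next
    case (step i)
    have Fi: "F i = insert (v (Suc i)) (F (Suc i))" "v (Suc i) \<notin> F (Suc i)"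
      using bspec[OF conjunct2[OF F_chain], of "Suc i"] step.hyps by auto
    have "finite (F (Suc i))"
      using F_sub[of "Suc i"] fin step.hyps by (auto intro: finite_subset)
    then have "card (F i) = Suc (card (F (Suc i)))"
      using Fi by simp
    moreover have "{i<..?d} = insert (Suc i) {Suc i<..?d}"
      using step.hyps by auto
    ultimately show ?case
      using step Fi by auto
  qed
  \<comment> \<open>\<open>F 0\<close> has \<open>card P\<close> more elements than the last set but
    lies in \<open>P\<close>, so the last set is empty and \<open>F 0\<close> is all of
    \<open>P\<close>.\<close>
  have "card (F 0) \<le> ?d"
    using card_mono[OF fin F_sub[of 0]] by simp
  then have "card (F ?d) = 0" and card0: "card (F 0) = ?d"
    using F_eq[of 0] by auto
  then have "F ?d = {}"
    using finite_subset[OF F_sub[of ?d] fin] by simp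
  then have F_image: "F i = v ` {i<..?d}" if "i \<le> ?d" for i
    using F_eq[OF that] by simp
  have "F 0 = P"
    using card_subset_eq[OF fin F_sub[of 0] card0] by simp
  moreover have "{0<..?d} = {1..?d}" by auto
  ultimately have "v ` {1..?d} = P"
    using F_image[of 0] by simp
  then have "bij_betw v {1..?d} P"
    by (simp add: bij_betw_def eq_card_imp_inj_on)
  moreover have "\<C> = (\<lambda>k. v ` {k<..?d}) ` {..?d}"
    unfolding \<C> atLeast0AtMost using F_image by (intro image_cong) auto
  ultimately show ?thesis using that by blast
qed

theorem proposition3p18:
  fixes P :: "'a::order set"
    and d :: nat
    and K :: "('a \<Rightarrow> real) set"
    and \<epsilon> :: "'a \<Rightarrow> real"
    and v :: "nat \<Rightarrow> 'a"
    and C :: "nat \<Rightarrow> 'a list"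
  assumes "finite P"
    and "card P = d"
    and "maximal_enriched_chain P K"
    and "\<epsilon> = sgn_chain P K"
    and "chain_linear_extension P (supp P ` K) v"
    and "associated_chains P v C"
  shows "convex hull K =
    {f \<in> functions_on P.
       sorted ([0] @ map (\<lambda>i. M_tilde \<epsilon> (C i) f) [1..<d + 1] @ [1])}"
proof -
  have chain: "pred_on.chain (enriched_filters P) (enriched_greater P) K"
    using assms(3) by (simp add: maximal_enriched_chain_def pred_on.maxchain_def)
  then have K: "f \<in> enriched_filters P" if "f \<in> K" for f
    using that by (auto simp: pred_on.chain_def)
  obtain bij: "bij_betw v {1..d} P" and supp_K: "supp P ` K = (\<lambda>k. v ` {k<..d}) ` {..d}"
  proof (rule chain_linear_extensionE[OF assms(5,1)])
    show "A \<subseteq> P" if "A \<in> supp P ` K" for A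
      using that by (auto simp: supp_def)
  qed (use assms(2) that in simp)
  have "\<forall>k\<in>{..d}. \<exists>f\<in>K. supp P f = v ` {k<..d}"
    using supp_K by (metis (no_types, lifting) image_iff)
  then obtain g where g: "\<And>k. k \<le> d \<Longrightarrow> g k \<in> K" "\<And>k. k \<le> d \<Longrightarrow> supp P (g k) = v ` {k<..d}"
    by (metis atMost_iff)
  \<comment> \<open>Distinct members of a chain have strictly nested supports, so a support
    determines its member.\<close>
  have K_eq: "K = g ` {..d}"
  proof (intro equalityI subsetI)
    fix f assume f: "f \<in> K"
    then obtain k where k: "k \<le> d" "supp P f = v ` {k<..d}"
      using supp_K by (metis (no_types, lifting) atMost_iff image_iff)
    have "f = g k"
      using pred_on.chain_total[OF chain f g(1)[OF k(1)]] k g(2)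
      by (auto simp: enriched_greater_def)
    then show "f \<in> g ` {..d}" using k(1) by blast
  qed (use g in auto)
  have inj: "inj_on v {1..d}" using bij by (rule bij_betw_imp_inj_on)
  have filter: "order_filter P (v ` {k<..d})" if "k \<le> d" for k
    using K[OF g(1)[OF that]] g(2)[OF that] by (simp add: enriched_filters_def)
  \<comment> \<open>The filter belonging to \<open>i - 1\<close> consists of the elements with index
    at least \<open>i\<close>; it contains \<open>v i\<close>, hence also
    \<open>v j\<close>.\<close>
  have less: "i < j" if "i \<in> {1..d}" "j \<in> {1..d}" "v i < v j" for i j
  proof -
    have "v i \<in> v ` {i - 1<..d}" "v j \<in> P"
      using that bij by (auto simp: bij_betw_def)
    then have "v j \<in> v ` {i - 1<..d}"
      using filter[of "i - 1"] that unfolding order_filter_def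
      by (meson atLeastAtMost_iff diff_le_self order_trans)
    then have "i \<le> j"
      using inj that by (force dest: inj_onD)
    then show ?thesis using that by (cases "i = j") auto
  qed
  \<comment> \<open>Off the minimal elements of the support the value -1 is excluded, which leaves
    1.\<close>
  have val: "f w = (if minimal_in (supp P f) w then \<epsilon> w else 1)"
    if "f \<in> K" "w \<in> supp P f" for f w
    using K[OF that(1)] that(2) sgn_chain_eq[OF chain that(1), of w] assms(4)
    by (auto simp: enriched_filters_def supp_def)
  \<comment> \<open>Each \<open>v i\<close> is minimal in the support of \<open>g (i - 1)\<close>,
    so its sign is a nonzero value of that vertex.\<close>
  have sign: "\<epsilon> w \<in> {1, -1}" if "w \<in> P" for w
  proof -
    have "w \<in> v ` {1..d}"
      using that bij by (simp add: bij_betw_def)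
    then obtain i where i: "i \<in> {1..d}" "w = v i" by blast
    let ?f = "g (i - 1)"
    have le: "i - 1 \<le> d" using i by auto
    have "v i \<in> supp P ?f" using g(2)[OF le] i by auto
    moreover have "\<not> u < v i" if u: "u \<in> supp P ?f" for u
    proof
      assume "u < v i"
      moreover obtain j where "j \<in> {i - 1<..d}" "u = v j"
        using u g(2)[OF le] by auto
      ultimately show False using less[of j i] i by auto
    qed
    ultimately have "minimal_in (supp P ?f) w" "w \<in> supp P ?f"
      using i by (auto simp: minimal_in_def)
    then have "?f w = \<epsilon> w"
      using val[OF g(1)[OF le]] by simp
    moreover have "?f w \<in> {1, -1}"
      using K[OF g(1)[OF le]] \<open>w \<in> supp P ?f\<close> by (auto simp: enriched_filters_def supp_def)
    ultimately show ?thesis by simp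
  qed
  interpret signed_linear_extension P v C \<epsilon>
    by unfold_locales (unfold assms(2), fact assms(1), fact bij, fact less, fact assms(6), fact sign)
  have g_on: "g k \<in> functions_on P" if "k \<le> d" for k
    using K[OF g(1)[OF that]] by (simp add: enriched_filters_def)
  show ?thesis
    unfolding K_eq
    by (rule convex_hull_vertices[of g, unfolded assms(2)]) (fact g_on, fact g(2), rule val[OF g(1)])
qed

end
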